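(* Let $L$ be a finite lattice and $P\subseteq L$. If the dependency digraph of $P$ contains a directed cycle, then $P$ is not order-induced submodular in $L$, i.e. there are no submodular function $f\colon L\to\mathbb R_{\ge0}$ and real number $k$ such that $P=\{a\in L\mid f(a)<k\}$.
   Context: A function $f\colon L\to\mathbb R_{\ge0}$ on a lattice $L$ is submodular if $f(a\vee b)+f(a\wedge b)\le f(a)+f(b)$ for all $a,b\in L$. For a subset $P$ of a lattice $L$, the dependency digraph of $P$ is the directed graph with vertex set $L$ in which $(a,b)$ is an edge if and only if one of the following holds: (i) $a\in L\setminus P$ and $b\in P$; (ii) $a,b\in P$ and there is some $c\in P$ such that either $b=a\vee c$ and $a\wedge c\notin P$, or $b=a\wedge c$ and $a\vee c\notin P$; (iii) $a,b\notin P$ and there is some $c\in P$ such that either $b=a\vee c$ and $a\wedge c\notin P$, or $b=a\wedge c$ and $a\vee c\notin P$. *)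

theory Defs
  imports Complex_Main "Graph_Theory.Pair_Digraph"
begin

definition submodular :: "('a::lattice \<Rightarrow> real) \<Rightarrow> bool" where
  "submodular f \<longleftrightarrow> (\<forall>a b. f (sup a b) + f (inf a b) \<le> f a + f b)"

definition order_induced_submodular :: "'a::lattice set \<Rightarrow> bool" where
  "order_induced_submodular P \<longleftrightarrow>
     (\<exists>(f :: 'a \<Rightarrow> real) (k :: real). (\<forall>a. 0 \<le> f a) \<and> submodular f \<and> P = {a. f a < k})"

definition dependency_digraph :: "'a::lattice set \<Rightarrow> 'a pair_pre_digraph" where
  "dependency_digraph P =
     \<lparr> pverts = UNIV,
       parcs = {(a, b).
         (a \<notin> P \<and> b \<in> P) \<or>
         (a \<in> P \<and> b \<in> P \<and>
           (\<exists>c\<in>P. (b = sup a c \<and> inf a c \<notin> P) \<or> (b = inf a c \<and> sup a c \<notin> P))) \<or>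
         (a \<notin> P \<and> b \<notin> P \<and>
           (\<exists>c\<in>P. (b = sup a c \<and> inf a c \<notin> P) \<or> (b = inf a c \<and> sup a c \<notin> P)))} \<rparr>"

end

theory Submission
  imports Defs
begin

text \<open>
  If \<open>P = {a. f a < k}\<close> with \<open>f\<close> submodular, then \<open>f\<close> strictly decreases along every arc of the
  dependency digraph: for an arc from \<open>a\<close> obtained with \<open>c \<in> P\<close>, the discarded one of
  \<open>sup a c\<close> and \<open>inf a c\<close> lies outside \<open>P\<close>, so its value exceeds \<open>f c\<close>. Hence there is no
  directed cycle.
\<close>

lemma dependency_arc_decreasing:
  fixes f :: "'a::lattice \<Rightarrow> real"
  assumes "submodular f" and P: "P = {a. f a < k}"
    and arc: "(a, b) \<in> parcs (dependency_digraph P)"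
  shows "f b < f a"
proof -
  have sub: "f (sup a c) + f (inf a c) \<le> f a + f c" for c
    using assms(1) by (simp add: submodular_def)
  \<comment> \<open>Arcs within \<open>P\<close> and arcs within its complement carry the same
    condition on \<open>c\<close>, so they are merged and split by join or meet instead.\<close>
  consider "a \<notin> P" "b \<in> P"
    | c where "c \<in> P" "b = sup a c" "inf a c \<notin> P"
    | c where "c \<in> P" "b = inf a c" "sup a c \<notin> P"
    using arc by (auto simp: dependency_digraph_def)
  then show ?thesis
  proof cases
    case 1
    then show ?thesis by (simp add: P)
  next
    case (2 c)
    then show ?thesis using sub[of c] by (simp add: P)
  next
    case (3 c)
    then show ?thesis using sub[of c] by (simp add: P)
  qed
qed

text \<open>Strict decrease along single arcs chains by transitivity; \<open>p \<noteq> []\<close>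
  keeps the result strict.\<close>

lemma cas_decreasing:
  fixes f :: "'a \<Rightarrow> 'c::order"
  assumes "\<And>e. e \<in> arcs G \<Longrightarrow> f (head G e) < f (tail G e)"
    and "pre_digraph.cas G u p v" and "set p \<subseteq> arcs G" and "p \<noteq> []"
  shows "f v < f u"
  using assms(2-)
proof (induction p arbitrary: u)
  case Nil
  then show ?case by simp
next
  case (Cons e p)
  have e: "f (head G e) < f u" and p: "pre_digraph.cas G (head G e) p v"
    using Cons.prems assms(1)[of e] by (auto simp: pre_digraph.cas.simps)
  show ?case
  proof (cases "p = []")
    \<comment> \<open>The single arc is the real base case: here \<open>v\<close> is the head of
      \<open>e\<close>.\<close>
    case True
    then show ?thesis using e p by (simp add: pre_digraph.cas.simps)
  next
    case False
    then show ?thesis using Cons.IH[OF p] Cons.prems(2) e by (auto intro: less_trans)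
  qed
qed

theorem corollary4p2:
  fixes P :: "'a::{finite, lattice} set"
  assumes "\<exists>p. pre_digraph.cycle (with_proj (dependency_digraph P)) p"
  shows "\<not> order_induced_submodular P"
proof
  assume "order_induced_submodular P"
  then obtain f :: "'a \<Rightarrow> real" and k where "submodular f" and "P = {a. f a < k}"
    by (auto simp: order_induced_submodular_def)
  then have arc: "f (head (with_proj (dependency_digraph P)) e)
      < f (tail (with_proj (dependency_digraph P)) e)"
    if "e \<in> arcs (with_proj (dependency_digraph P))" for e
    using that dependency_arc_decreasing[of f P k "fst e" "snd e"]
    by (simp add: with_proj_def)
  \<comment> \<open>A cycle is a nonempty closed walk, so the chained decrease yields
    \<open>f u < f u\<close>.\<close>
  obtain p u where "pre_digraph.cas (with_proj (dependency_digraph P)) u p u"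
    and "set p \<subseteq> arcs (with_proj (dependency_digraph P))" and "p \<noteq> []"
    using assms by (auto simp: pre_digraph.cycle_def pre_digraph.awalk_def)
  from cas_decreasing[of _ f, OF arc this] show False by simp
qed

end
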